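(* Let $\mathcal{B}$ be a Cosserat continuum with mechanical response $W:\tilde J^1(F\mathcal B)\to V$, and let $\overline{\Omega}(\mathcal{B})\subseteq \tilde J^1(F\mathcal B)$ be the set of all classes of $1$-jets $j^1_{x,y}\Psi$ ($x,y\in\mathcal B$) that leave $W$ invariant, in the sense specified in the context. Then $\mathcal{B}$ is uniform if, and only if, $\overline{\Omega}(\mathcal{B})$ is a reduced subgroupoid of $\tilde{J}^{1}(F\mathcal{B})$ (that is, a transitive subgroupoid with base $\mathcal B$).
   Context: Frame bundles. For an $n$-manifold $M$, $FM\to M$ is the linear frame bundle, with its right action of $Gl(n,\mathbb R)$; a frame at $x$ is a $1$-jet $j^1_{0,x}\phi$ of a local diffeomorphism $\phi:\mathbb R^n\to M$ with $\phi(0)=x$. For a local diffeomorphism $\psi$, $F\psi(j^1_{0,\phi(0)}\phi)=j^1_{0,\psi(\phi(0))}(\psi\circ\phi)$. $\tau_v$ is translation of $\mathbb R^n$ by $v$. A local principal bundle isomorphism (over the identity of $Gl(n,\mathbb R)$) is a diffeomorphism $\Psi:FU\to FV$ ($U,V$ open) with $\Psi(z\cdot g)=\Psi(z)\cdot g$; it induces a diffeomorphism $\psi:U\to V$. Second-order non-holonomic groupoid. $\tilde J^1(FM)\rightrightarrows M$ is the quotient of the groupoid of $1$-jets $j^1_{X,Y}\Psi$ ($X,Y=\Psi(X)\in FM$) of local principal bundle isomorphisms of $FM$, by the action $j^1_{X,Y}\Psi\cdot g=j^1_{X\cdot g,Y\cdot g}\Psi$ of $Gl(n,\mathbb R)$.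 The class of $j^1_{X,Y}\Psi$ with $X$ over $x$ and $Y$ over $y$ is written $j^1_{x,y}\Psi$; its source is $x$, its target is $y$, and composition is composition of jets. Cosserat media. A body $\mathcal B$ is a $3$-manifold which can be covered by one chart; a Cosserat medium is $F\mathcal B$ (and $\mathcal B$ is called the Cosserat continuum). A configuration is an embedding of principal bundles $F\mathcal B\to F\mathbb R^3$ inducing the identity on $Gl(3,\mathbb R)$. A reference configuration $\Psi_0$ is fixed and $F\mathcal B$ is identified with its image, so $\mathcal B$ is an open subset of $\mathbb R^3$. A deformation is a configuration change $\tilde\kappa$, i.e. with this identification an embedding of principal bundles $\tilde\kappa:F\mathcal B\to F\mathbb R^3$ over the identity of $Gl(3,\mathbb R)$, with induced map $\kappa:\mathcal B\to\mathbb R^3$; its class of $1$-jets $j^1_{y,\kappa(y)}\tilde\kappa$ is an infinitesimal deformation at $y$. The mechanical response is a differentiable map $W:\tilde J^1(F\mathcal B)\to V$ ($V$ a real vector space) not depending on the end point: $W(j^1_{x,y}\Psi)=W(j^1_{x,z}(F\tau_{z-y}\circ\Psi))$. By this property $W$ is also defined on the open subset of $\tilde J^1(F\mathbb R^3)$ of elements with source in $\mathcal B$ and target in $\mathbb R^3$. $\overline\Omega(\mathcal B)$ consists of the $j^1_{x,y}\Psi\in\tilde J^1(F\mathcal B)$ such that $W(j^1_{y,\kappa(y)}\tilde\kappa\cdot j^1_{x,y}\Psi)=W(j^1_{y,\kappa(y)}\tilde\kappa)$ for all infinitesimal deformations $j^1_{y,\kappa(y)}\tilde\kappa$ at $y$;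 it is a subgroupoid. $\mathcal B$ is uniform if for any two points $x,y\in\mathcal B$ there is a local principal bundle isomorphism $\Psi$ from a neighbourhood $FU\subseteq F\mathcal B$ over $x$ to a neighbourhood $FV\subseteq F\mathcal B$ over $y$, over the identity of $Gl(3,\mathbb R)$, with $\psi(x)=y$ and $W(j^1_{y,\kappa(y)}\tilde\kappa\cdot j^1_{x,y}\Psi)=W(j^1_{y,\kappa(y)}\tilde\kappa)$ for all infinitesimal deformations at $y$. A groupoid is transitive if any two points of the base are the source and target of some element. *)

theory Defs
  imports "HOL-Analysis.Analysis"
begin

section \<open>Smooth maps between open subsets of normed spaces\<close>

text \<open>
  On an open subset of a finite-dimensional space, a map all of whose iterated directional
  derivatives of order at most \<open>k\<close> exist and are continuous is of class \<open>C\<^sup>k\<close>.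
\<close>

primrec Ck_on :: "nat \<Rightarrow> 'a::real_normed_vector set \<Rightarrow> ('a \<Rightarrow> 'b::real_normed_vector) \<Rightarrow> bool" where
  "Ck_on 0 S f \<longleftrightarrow> continuous_on S f"
| "Ck_on (Suc k) S f \<longleftrightarrow>
     (\<forall>x\<in>S. f differentiable (at x)) \<and> (\<forall>v. Ck_on k S (\<lambda>x. frechet_derivative f (at x) v))"

definition smooth_on :: "'a::real_normed_vector set \<Rightarrow> ('a \<Rightarrow> 'b::real_normed_vector) \<Rightarrow> bool" where
  "smooth_on S f \<longleftrightarrow> (\<forall>k. Ck_on k S f)"

definition diffeomorphism_on ::
  "'a::real_normed_vector set \<Rightarrow> 'b::real_normed_vector set \<Rightarrow> ('a \<Rightarrow> 'b) \<Rightarrow> bool" where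
  "diffeomorphism_on S T f \<longleftrightarrow>
     bij_betw f S T \<and> smooth_on S f \<and> smooth_on T (inv_into S f)"

definition smooth_embedding_on ::
  "'a::real_normed_vector set \<Rightarrow> ('a \<Rightarrow> 'b::real_normed_vector) \<Rightarrow> bool" where
  "smooth_embedding_on S f \<longleftrightarrow>
     smooth_on S f \<and> (\<forall>x\<in>S. inj (frechet_derivative f (at x))) \<and>
     (\<exists>g. homeomorphism S (f ` S) f g)"

section \<open>Frame bundles\<close>

text \<open>
  The frame \<open>j\<^sup>1\<^bsub>0,x\<^esub> \<phi>\<close> of \<open>\<real>\<^sup>n\<close> is encoded by the pair \<open>(\<phi> 0, D\<phi>(0)) = (x, A)\<close> with
  \<open>A\<close> invertible. Over an open set \<open>U\<close> the frame bundle is thus the open subset \<open>U \<times> Gl(n)\<close> of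
  the Euclidean space of all pairs of a point and a matrix.
\<close>

type_synonym 'n frame = "(real ^ 'n) \<times> (real ^ 'n ^ 'n)"

definition GL :: "(real ^ 'n ^ 'n) set" where
  "GL = {A. invertible A}"

definition frame_bundle :: "(real ^ 'n) set \<Rightarrow> 'n frame set" where
  "frame_bundle U = U \<times> GL"

definition frame_act :: "'n::finite frame \<Rightarrow> real ^ 'n ^ 'n \<Rightarrow> 'n frame" where
  "frame_act X g = (fst X, snd X ** g)"

text \<open>\<open>F\<psi>\<close>: by the chain rule, \<open>j\<^sup>1(\<psi> \<circ> \<phi>)\<close> at \<open>0\<close> is encoded by \<open>(\<psi> x, D\<psi>(x) A)\<close>.\<close>

definition frame_lift :: "(real ^ 'n \<Rightarrow> real ^ 'n) \<Rightarrow> 'n::finite frame \<Rightarrow> 'n frame" where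
  "frame_lift \<psi> X =
     (\<psi> (fst X), matrix (frechet_derivative \<psi> (at (fst X))) ** snd X)"

definition translation :: "real ^ 'n \<Rightarrow> real ^ 'n \<Rightarrow> real ^ 'n" where
  "translation v x = x + v"

definition equivariant_on :: "(real ^ 'n) set \<Rightarrow> ('n::finite frame \<Rightarrow> 'n frame) \<Rightarrow> bool" where
  "equivariant_on U \<Psi> \<longleftrightarrow>
     (\<forall>X\<in>frame_bundle U. \<forall>g\<in>GL. \<Psi> (frame_act X g) = frame_act (\<Psi> X) g)"

definition local_bundle_iso ::
  "(real ^ 'n) set \<Rightarrow> (real ^ 'n) set \<Rightarrow> ('n::finite frame \<Rightarrow> 'n frame) \<Rightarrow> bool" where
  "local_bundle_iso U V \<Psi> \<longleftrightarrow>
     open U \<and> open V \<and> diffeomorphism_on (frame_bundle U) (frame_bundle V) \<Psi> \<and>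
     equivariant_on U \<Psi>"

text \<open>The induced map \<open>\<psi>\<close>; by equivariance any frame over \<open>x\<close> could replace \<open>(x, I)\<close>.\<close>

definition base_map :: "('n::finite frame \<Rightarrow> 'n frame) \<Rightarrow> real ^ 'n \<Rightarrow> real ^ 'n" where
  "base_map \<Psi> x = fst (\<Psi> (x, mat 1))"

section \<open>The second-order non-holonomic groupoid\<close>

text \<open>
  A 1-jet \<open>j\<^sup>1\<^bsub>X,Y\<^esub> \<Psi>\<close> is encoded by \<open>(X, Y, D\<Psi>(X))\<close>: two maps have the same 1-jet at \<open>X\<close>
  iff they agree there together with their first derivatives.
\<close>

type_synonym 'n jet = "'n frame \<times> 'n frame \<times> ('n frame \<Rightarrow> 'n frame)"

definition jet1 :: "('n::finite frame \<Rightarrow> 'n frame) \<Rightarrow> 'n frame \<Rightarrow> 'n jet" where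
  "jet1 \<Psi> X = (X, \<Psi> X, frechet_derivative \<Psi> (at X))"

text \<open>
  The class \<open>j\<^sup>1\<^bsub>x,y\<^esub> \<Psi>\<close>, i.e. the orbit of any \<open>j\<^sup>1\<^bsub>X,Y\<^esub> \<Psi>\<close> with \<open>X\<close> over \<open>x\<close> under the action
  \<open>j\<^sup>1\<^bsub>X,Y\<^esub> \<Psi> \<cdot> g = j\<^sup>1\<^bsub>X\<cdot>g,Y\<cdot>g\<^esub> \<Psi>\<close>; here \<open>X\<cdot>g\<close> runs through the whole fibre over \<open>x\<close>.
\<close>

definition jet_class :: "real ^ 'n \<Rightarrow> ('n::finite frame \<Rightarrow> 'n frame) \<Rightarrow> 'n jet set" where
  "jet_class x \<Psi> = jet1 \<Psi> ` frame_bundle {x}"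

definition nonholonomic_groupoid :: "(real ^ 'n::finite) set \<Rightarrow> 'n jet set set" where
  "nonholonomic_groupoid M =
     {jet_class x \<Psi> | x \<Psi> U V. local_bundle_iso U V \<Psi> \<and> U \<subseteq> M \<and> V \<subseteq> M \<and> x \<in> U}"

text \<open>All members of a class project to the same source and target in the base.\<close>

definition jet_source :: "'n jet set \<Rightarrow> real ^ 'n" where
  "jet_source c = the_elem ((\<lambda>(X, Y, L). fst X) ` c)"

definition jet_target :: "'n jet set \<Rightarrow> real ^ 'n" where
  "jet_target c = the_elem ((\<lambda>(X, Y, L). fst Y) ` c)"

text \<open>\<open>jet_comp d c\<close> is \<open>d \<cdot> c\<close>: first \<open>c\<close>, then \<open>d\<close>.\<close>

definition jet_comp :: "'n jet set \<Rightarrow> 'n jet set \<Rightarrow> 'n jet set" where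
  "jet_comp d c = {(X, Z, L' \<circ> L) | X Y Z L L'. (X, Y, L) \<in> c \<and> (Y, Z, L') \<in> d}"

definition jet_inverse :: "'n jet set \<Rightarrow> 'n jet set" where
  "jet_inverse c = {(Y, X, inv L) | X Y L. (X, Y, L) \<in> c}"

definition jet_identity :: "real ^ 'n \<Rightarrow> 'n::finite jet set" where
  "jet_identity x = jet_class x id"

definition subgroupoid ::
  "(real ^ 'n::finite) set \<Rightarrow> (real ^ 'n) set \<Rightarrow> 'n jet set set \<Rightarrow> bool" where
  "subgroupoid M N \<Omega> \<longleftrightarrow>
     N \<subseteq> M \<and> \<Omega> \<subseteq> nonholonomic_groupoid M \<and>
     (\<forall>c\<in>\<Omega>. jet_source c \<in> N \<and> jet_target c \<in> N) \<and>
     (\<forall>x\<in>N. jet_identity x \<in> \<Omega>) \<and>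
     (\<forall>c\<in>\<Omega>. \<forall>d\<in>\<Omega>. jet_source d = jet_target c \<longrightarrow> jet_comp d c \<in> \<Omega>) \<and>
     (\<forall>c\<in>\<Omega>. jet_inverse c \<in> \<Omega>)"

definition transitive_over :: "(real ^ 'n) set \<Rightarrow> 'n jet set set \<Rightarrow> bool" where
  "transitive_over N \<Omega> \<longleftrightarrow>
     (\<forall>x\<in>N. \<forall>y\<in>N. \<exists>c\<in>\<Omega>. jet_source c = x \<and> jet_target c = y)"

definition reduced_subgroupoid :: "(real ^ 'n::finite) set \<Rightarrow> 'n jet set set \<Rightarrow> bool" where
  "reduced_subgroupoid M \<Omega> \<longleftrightarrow> subgroupoid M M \<Omega> \<and> transitive_over M \<Omega>"

section \<open>Cosserat media\<close>

text \<open>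
  The manifold structure of the groupoid over an open set \<open>M\<close> is given by one global chart. Near
  \<open>x\<close>, a local isomorphism has the form \<open>(u, G) \<mapsto> (\<psi> u, \<Phi> u G)\<close>, and its class at \<open>x\<close> has the
  coordinates \<open>(x, y, P, A, C) = (x, \<psi> x, \<Phi> x, D\<psi>(x), D\<Phi>(x))\<close>, which range over the open set
  \<open>M \<times> M \<times> Gl(n) \<times> Gl(n) \<times> Hom(\<real>\<^sup>n, gl(n))\<close>. The inverse of the chart is:
\<close>

definition jet_of_coords ::
  "(real ^ 'n) \<times> (real ^ 'n) \<times> (real ^ 'n ^ 'n) \<times> (real ^ 'n ^ 'n)
     \<times> ((real ^ 'n) \<Rightarrow>\<^sub>L (real ^ 'n ^ 'n)) \<Rightarrow> 'n::finite jet set" where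
  "jet_of_coords = (\<lambda>(x, y, P, A, C).
     jet_class x (\<lambda>(u, G). (y + A *v (u - x), (P + blinfun_apply C (u - x)) ** G)))"

definition differentiable_response ::
  "(real ^ 'n::finite) set \<Rightarrow> ('n jet set \<Rightarrow> 'v::real_normed_vector) \<Rightarrow> bool" where
  "differentiable_response M W \<longleftrightarrow>
     (\<lambda>p. W (jet_of_coords p)) differentiable_on (M \<times> M \<times> GL \<times> GL \<times> UNIV)"

definition endpoint_independent ::
  "(real ^ 'n::finite) set \<Rightarrow> ('n jet set \<Rightarrow> 'v) \<Rightarrow> bool" where
  "endpoint_independent M W \<longleftrightarrow>
     (\<forall>U V \<Psi>. local_bundle_iso U V \<Psi> \<and> U \<subseteq> M \<and> V \<subseteq> M \<longrightarrow>
        (\<forall>x\<in>U. \<forall>z\<in>M.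
           W (jet_class x \<Psi>) =
           W (jet_class x (frame_lift (translation (z - base_map \<Psi> x)) \<circ> \<Psi>))))"

text \<open>\<open>W\<close> is a total function, but only its values on \<open>nonholonomic_groupoid M\<close> matter.\<close>

definition mechanical_response ::
  "(real ^ 'n::finite) set \<Rightarrow> ('n jet set \<Rightarrow> 'v::real_normed_vector) \<Rightarrow> bool" where
  "mechanical_response M W \<longleftrightarrow> differentiable_response M W \<and> endpoint_independent M W"

text \<open>
  Extension of \<open>W\<close> to classes with source in the body and arbitrary target \<open>z\<close>: the target is first
  translated back into the body. By end-point independence any point of the body serves; the source
  \<open>x\<close> is taken, so the value at \<open>j\<^sup>1\<^bsub>x,z\<^esub> \<Psi>\<close> is \<open>W (j\<^sup>1\<^bsub>x,x\<^esub> (F\<tau>\<^bsub>x-z\<^esub> \<circ> \<Psi>))\<close>.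
\<close>

definition extended_response :: "('n::finite jet set \<Rightarrow> 'v) \<Rightarrow> 'n jet set \<Rightarrow> 'v" where
  "extended_response W c =
     W (jet_comp
          (jet_class (jet_target c) (frame_lift (translation (jet_source c - jet_target c)))) c)"

definition deformation :: "(real ^ 'n) set \<Rightarrow> ('n::finite frame \<Rightarrow> 'n frame) \<Rightarrow> bool" where
  "deformation M \<kappa> \<longleftrightarrow>
     \<kappa> ` frame_bundle M \<subseteq> frame_bundle UNIV \<and>
     smooth_embedding_on (frame_bundle M) \<kappa> \<and> equivariant_on M \<kappa>"

definition infinitesimal_deformations ::
  "(real ^ 'n::finite) set \<Rightarrow> real ^ 'n \<Rightarrow> 'n jet set set" where
  "infinitesimal_deformations M y = {jet_class y \<kappa> | \<kappa>. deformation M \<kappa>}"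

definition leaves_invariant ::
  "(real ^ 'n::finite) set \<Rightarrow> ('n jet set \<Rightarrow> 'v) \<Rightarrow> 'n jet set \<Rightarrow> bool" where
  "leaves_invariant M W c \<longleftrightarrow>
     (\<forall>k\<in>infinitesimal_deformations M (jet_target c).
        extended_response W (jet_comp k c) = extended_response W k)"

definition material_groupoid ::
  "(real ^ 'n::finite) set \<Rightarrow> ('n jet set \<Rightarrow> 'v) \<Rightarrow> 'n jet set set" where
  "material_groupoid M W = {c \<in> nonholonomic_groupoid M. leaves_invariant M W c}"

definition uniform_body ::
  "(real ^ 'n::finite) set \<Rightarrow> ('n jet set \<Rightarrow> 'v) \<Rightarrow> bool" where
  "uniform_body M W \<longleftrightarrow>
     (\<forall>x\<in>M. \<forall>y\<in>M. \<exists>U V \<Psi>.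
        local_bundle_iso U V \<Psi> \<and> U \<subseteq> M \<and> V \<subseteq> M \<and> x \<in> U \<and> y \<in> V \<and>
        base_map \<Psi> x = y \<and>
        (\<forall>k\<in>infinitesimal_deformations M y.
           extended_response W (jet_comp k (jet_class x \<Psi>)) = extended_response W k))"

end

theory Submission
  imports Defs
begin

text \<open>
  Uniformity is just transitivity of the material groupoid, so the content is that the latter is
  always a subgroupoid. The invariance condition quantifies over deformations of the whole body,
  whereas composing a deformation with a local isomorphism yields a map that is only defined locally.
  However, the class of an equivariant map at \<open>y\<close> depends only on the data
  \<open>(\<psi> y, \<Phi> y, D\<psi>(y), D\<Phi>(y)) = (z, P, A, C)\<close>, and any such data with \<open>A, P\<close> invertible is realized by
  the global embedding
  \<open>(u, G) \<mapsto> (z + A(u - y), (P + C(u - y) / (1 + K|u - y|\<^sup>2)) G)\<close> for \<open>K\<close> large. Hence the infinitesimal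
  deformations are stable under composition with classes of local isomorphisms, and closure of the
  material groupoid under composition and inversion becomes jet algebra.
\<close>

section \<open>Smooth maps\<close>

lemma Ck_on_subset: "Ck_on k S f \<Longrightarrow> T \<subseteq> S \<Longrightarrow> Ck_on k T f"
  by (induction k arbitrary: f) (auto intro: continuous_on_subset)

text \<open>Openness turns equality on \<open>S\<close> into equality of derivatives at the points
  of \<open>S\<close>, so the induction can pass to the directional derivatives.\<close>

lemma Ck_on_cong:
  assumes "open S" "\<And>x. x \<in> S \<Longrightarrow> f x = g x" "Ck_on k S f"
  shows "Ck_on k S g"
  using assms(2,3)
proof (induction k arbitrary: f g)
  case 0
  then show ?case by (simp cong: continuous_on_cong)
next
  case (Suc k)
  have "g differentiable (at x)" if "x \<in> S" for x
    using Suc.prems that \<open>open S\<close>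
    by (metis Ck_on.simps(2) differentiable_def has_derivative_transform_within_open)
  moreover have "Ck_on k S (\<lambda>x. frechet_derivative g (at x) v)" for v
  proof (rule Suc.IH)
    show "Ck_on k S (\<lambda>x. frechet_derivative f (at x) v)"
      using Suc.prems by simp
    show "frechet_derivative f (at x) v = frechet_derivative g (at x) v" if "x \<in> S" for x
      using frechet_derivative_transform_within_open[of f x S g] Suc.prems that \<open>open S\<close> by auto
  qed
  ultimately show ?case by simp
qed

text \<open>Lets an explicit derivative \<open>f'\<close> stand in for
  \<open>frechet_derivative\<close>, so that a closure property follows from a differentiation rule
  and the induction hypothesis applied to the resulting formula.\<close>

lemma Ck_on_SucI:
  assumes "open S" "\<And>x. x \<in> S \<Longrightarrow> (f has_derivative f' x) (at x)"
    and "\<And>v. Ck_on k S (\<lambda>x. f' x v)"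
  shows "Ck_on (Suc k) S f"
proof -
  have "Ck_on k S (\<lambda>x. frechet_derivative f (at x) v)" for v
    by (rule Ck_on_cong[OF \<open>open S\<close> _ assms(3)[of v]])
      (simp add: frechet_derivative_at[OF assms(2), symmetric])
  then show ?thesis
    using assms(2) by (auto simp: differentiable_def)
qed

lemma Ck_on_Suc_has_derivative:
  assumes "Ck_on (Suc k) S f" "x \<in> S"
  shows "(f has_derivative frechet_derivative f (at x)) (at x)"
  using assms by (simp add: frechet_derivative_works[symmetric])

text \<open>Product and chain rules mix a function with its derivatives; this lowers the order of
  the undifferentiated factor to that of the derivatives.\<close>

lemma Ck_on_SucD: "Ck_on (Suc k) S f \<Longrightarrow> Ck_on k S f"
proof (induction k arbitrary: f)
  case 0
  then show ?case
    by (auto intro!: continuous_at_imp_continuous_on differentiable_imp_continuous_within)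
qed auto

lemma Ck_on_const: "Ck_on k S (\<lambda>x. c)"
  by (induction k arbitrary: c) auto

lemma Ck_on_bounded_linear:
  assumes "bounded_linear h"
  shows "open S \<Longrightarrow> Ck_on k S f \<Longrightarrow> Ck_on k S (\<lambda>x. h (f x))"
proof (induction k arbitrary: f)
  case 0
  then show ?case
    by (simp add: linear_continuous_on_compose assms bounded_linear.continuous_on)
next
  case (Suc k)
  show ?case
    by (rule Ck_on_SucI[OF \<open>open S\<close> bounded_linear.has_derivative[OF assms
          Ck_on_Suc_has_derivative[OF Suc.prems(2)]]]) (use Suc in auto)
qed

lemma Ck_on_ident: "open S \<Longrightarrow> Ck_on k S (\<lambda>x. x)"
  by (cases k) (auto simp: Ck_on_const)

lemma Ck_on_add:
  "open S \<Longrightarrow> Ck_on k S f \<Longrightarrow> Ck_on k S g \<Longrightarrow> Ck_on k S (\<lambda>x. f x + g x)"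
proof (induction k arbitrary: f g)
  case 0
  then show ?case by (simp add: continuous_on_add)
next
  case (Suc k)
  show ?case
    by (rule Ck_on_SucI[OF \<open>open S\<close> has_derivative_add[OF
          Ck_on_Suc_has_derivative[OF Suc.prems(2)] Ck_on_Suc_has_derivative[OF Suc.prems(3)]]])
      (use Suc in auto)
qed

lemma Ck_on_sum:
  "finite I \<Longrightarrow> open S \<Longrightarrow> (\<And>i. i \<in> I \<Longrightarrow> Ck_on k S (f i)) \<Longrightarrow> Ck_on k S (\<lambda>x. \<Sum>i\<in>I. f i x)"
  by (induction I rule: finite_induct) (auto intro: Ck_on_add Ck_on_const)

lemma Ck_on_bilinear:
  assumes "bounded_bilinear h"
  shows "open S \<Longrightarrow> Ck_on k S f \<Longrightarrow> Ck_on k S g \<Longrightarrow> Ck_on k S (\<lambda>x. h (f x) (g x))"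
proof (induction k arbitrary: f g)
  case 0
  then show ?case by (simp add: bounded_bilinear.continuous_on[OF assms])
next
  case (Suc k)
  show ?case
    by (rule Ck_on_SucI[OF \<open>open S\<close> bounded_bilinear.FDERIV[OF assms
          Ck_on_Suc_has_derivative[OF Suc.prems(2)] Ck_on_Suc_has_derivative[OF Suc.prems(3)]]])
      (use Suc Ck_on_SucD[OF Suc.prems(2)] Ck_on_SucD[OF Suc.prems(3)]
        in \<open>auto intro!: Ck_on_add Suc.IH\<close>)
qed

lemma Ck_on_Pair:
  assumes "open S" "Ck_on k S f" "Ck_on k S g"
  shows "Ck_on k S (\<lambda>x. (f x, g x))"
proof -
  \<comment> \<open>A pair is a sum of two bounded linear images, so no separate induction is
    needed.\<close>
  have "Ck_on k S (\<lambda>x. (f x, 0) + (0, g x))"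
    using assms
    by (intro Ck_on_add Ck_on_bounded_linear[of "\<lambda>a. (a, 0)"] Ck_on_bounded_linear[of "Pair 0"]
        bounded_linear_Pair bounded_linear_ident bounded_linear_zero)
  then show ?thesis by simp
qed

lemma Ck_on_inverse:
  fixes f :: "'a::real_normed_vector \<Rightarrow> real"
  assumes "open S" "\<And>x. x \<in> S \<Longrightarrow> f x \<noteq> 0"
  shows "Ck_on k S f \<Longrightarrow> Ck_on k S (\<lambda>x. inverse (f x))"
proof (induction k)
  case 0
  then show ?case by (simp add: continuous_on_inverse assms)
next
  case (Suc k)
  have "Ck_on k S (\<lambda>x. - (inverse (f x) * frechet_derivative f (at x) v * inverse (f x)))" for v
    using Suc Ck_on_SucD[OF Suc.prems]
    by (intro Ck_on_bounded_linear[of uminus] bounded_linear_minus bounded_linear_ident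
        Ck_on_bilinear[OF bounded_bilinear_mult] \<open>open S\<close>) auto
  then show ?case
    by (intro Ck_on_SucI[OF \<open>open S\<close> Deriv.has_derivative_inverse[OF _
          Ck_on_Suc_has_derivative[OF Suc.prems]]]) (auto simp: assms)
qed

text \<open>In the chain rule derivative \<open>?g' (f x) (?f' x v)\<close> the direction varies
  with \<open>x\<close>, whereas \<open>Ck_on\<close> controls \<open>?g'\<close> only in fixed
  directions. Expanding \<open>?f' x v\<close> in the finite basis gives a sum of scalars times
  \<open>?g'\<close> along fixed basis vectors, evaluated at \<open>f x\<close>; the induction
  hypothesis, with \<open>g\<close> arbitrary, applies to each of these.\<close>

lemma Ck_on_compose:
  fixes f :: "'a::real_normed_vector \<Rightarrow> 'b::euclidean_space"
  assumes "open S" "open T" "f ` S \<subseteq> T"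
  shows "Ck_on k S f \<Longrightarrow> Ck_on k T g \<Longrightarrow> Ck_on k S (\<lambda>x. g (f x))"
proof (induction k arbitrary: g)
  case 0
  then show ?case using assms(3) by (auto intro: continuous_on_compose2)
next
  case (Suc k)
  let ?f' = "\<lambda>x. frechet_derivative f (at x)" and ?g' = "\<lambda>y. frechet_derivative g (at y)"
  have g': "(g has_derivative ?g' (f x)) (at (f x))" if "x \<in> S" for x
    by (rule Ck_on_Suc_has_derivative[OF Suc.prems(2)]) (use that assms in auto)
  show ?case
  proof (rule Ck_on_SucI[OF \<open>open S\<close>])
    show "((\<lambda>x. g (f x)) has_derivative
        (\<lambda>v. \<Sum>b\<in>Basis. (?f' x v \<bullet> b) *\<^sub>R ?g' (f x) b)) (at x)" if "x \<in> S" for x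
    proof -
      have lin: "linear (?g' (f x))"
        using g'[OF that] by (simp add: has_derivative_linear)
      have "?g' (f x) (\<Sum>b\<in>Basis. (w \<bullet> b) *\<^sub>R b) = (\<Sum>b\<in>Basis. (w \<bullet> b) *\<^sub>R ?g' (f x) b)" for w
        by (simp add: linear_sum[OF lin] linear_scale[OF lin])
      then have "?g' (f x) w = (\<Sum>b\<in>Basis. (w \<bullet> b) *\<^sub>R ?g' (f x) b)" for w
        unfolding euclidean_representation .
      then have "(\<lambda>v. \<Sum>b\<in>Basis. (?f' x v \<bullet> b) *\<^sub>R ?g' (f x) b) = (\<lambda>v. ?g' (f x) (?f' x v))"
        by (intro ext) (rule sym)
      then show ?thesis
        using has_derivative_compose[OF Ck_on_Suc_has_derivative[OF Suc.prems(1) that] g'[OF that]]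
        by (simp only:)
    qed
    show "Ck_on k S (\<lambda>x. \<Sum>b\<in>Basis. (?f' x v \<bullet> b) *\<^sub>R ?g' (f x) b)" for v
      using Suc.prems Ck_on_SucD[OF Suc.prems(1)]
      by (intro Ck_on_sum Ck_on_bilinear[OF bounded_bilinear_scaleR] \<open>open S\<close>
          Ck_on_bounded_linear[OF bounded_linear_inner_left] Suc.IH) auto
  qed
qed

section \<open>Smooth maps and diffeomorphisms: composition, inversion, restriction\<close>

lemma smooth_on_subset: "smooth_on S f \<Longrightarrow> T \<subseteq> S \<Longrightarrow> smooth_on T f"
  by (auto simp: smooth_on_def intro: Ck_on_subset)

lemma smooth_on_cong:
  "open S \<Longrightarrow> (\<And>x. x \<in> S \<Longrightarrow> f x = g x) \<Longrightarrow> smooth_on S f \<Longrightarrow> smooth_on S g"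
  unfolding smooth_on_def by (blast intro: Ck_on_cong)

lemma smooth_on_compose:
  fixes f :: "'a::real_normed_vector \<Rightarrow> 'b::euclidean_space"
  assumes "open S" "open T" "f ` S \<subseteq> T" "smooth_on S f" "smooth_on T g"
  shows "smooth_on S (g \<circ> f)"
  using Ck_on_compose[OF assms(1-3)] assms(4,5) unfolding smooth_on_def o_def by blast

lemma smooth_on_has_derivative:
  "smooth_on S f \<Longrightarrow> x \<in> S \<Longrightarrow> (f has_derivative frechet_derivative f (at x)) (at x)"
  using Ck_on_Suc_has_derivative[of 0] by (auto simp: smooth_on_def simp del: Ck_on.simps)

lemma smooth_on_continuous: "smooth_on S f \<Longrightarrow> continuous_on S f"
  using Ck_on.simps(1) unfolding smooth_on_def by blast

lemma diffeomorphism_on_compose: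
  fixes f :: "'a::euclidean_space \<Rightarrow> 'b::euclidean_space" and g :: "'b \<Rightarrow> 'c::euclidean_space"
  assumes "open S" "open T" "open R" "diffeomorphism_on S T f" "diffeomorphism_on T R g"
  shows "diffeomorphism_on S R (g \<circ> f)"
proof -
  have f: "bij_betw f S T" and g: "bij_betw g T R"
    using assms by (auto simp: diffeomorphism_on_def)
  have "smooth_on R (inv_into S f \<circ> inv_into T g)"
    using assms bij_betw_inv_into[OF g]
    by (intro smooth_on_compose[of _ T]) (auto simp: diffeomorphism_on_def bij_betw_def)
  \<comment> \<open>The two inverses are compared only on \<open>R\<close>, where
    \<open>inv_into\<close> returns genuine preimages; smoothness is then transferred by congruence
    on this open set.\<close>
  moreover have "(inv_into S f \<circ> inv_into T g) x = inv_into S (g \<circ> f) x" if "x \<in> R" for x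
    using inv_into_comp[of g f S x] f g that by (auto simp: bij_betw_def)
  ultimately have "smooth_on R (inv_into S (g \<circ> f))"
    by (rule smooth_on_cong[OF \<open>open R\<close>, rotated])
  moreover have "smooth_on S (g \<circ> f)"
    using assms f by (intro smooth_on_compose[of _ T]) (auto simp: diffeomorphism_on_def bij_betw_def)
  ultimately show ?thesis
    using bij_betw_trans[OF f g] by (simp add: diffeomorphism_on_def)
qed

lemma diffeomorphism_on_inverse:
  assumes "open S" "diffeomorphism_on S T f"
  shows "diffeomorphism_on T S (inv_into S f)"
proof -
  have f: "bij_betw f S T" using assms by (simp add: diffeomorphism_on_def)
  have "f x = inv_into T (inv_into S f) x" if "x \<in> S" for x
    using inv_into_inv_into_eq[OF f that] by simp
  then have "smooth_on S (inv_into T (inv_into S f))"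
    using assms smooth_on_cong[OF \<open>open S\<close>, of f] by (auto simp: diffeomorphism_on_def)
  then show ?thesis
    using assms bij_betw_inv_into[OF f] by (simp add: diffeomorphism_on_def)
qed

text \<open>Injectivity on the larger set \<open>S\<close> makes \<open>inv_into S f\<close> and
  \<open>inv_into S' f\<close> pick the same preimage of every point of the image of
  \<open>S'\<close>, so smoothness of the inverse is inherited.\<close>

lemma diffeomorphism_on_restrict:
  assumes "diffeomorphism_on S T f" "S' \<subseteq> S" "open (f ` S')"
  shows "diffeomorphism_on S' (f ` S') f"
proof -
  have f: "inj_on f S" and T: "f ` S = T"
    using assms by (auto simp: diffeomorphism_on_def bij_betw_def)
  have "inv_into S f y = inv_into S' f y" if "y \<in> f ` S'" for y
    using that f assms(2) by (auto simp: inv_into_f_f inj_on_subset subset_iff)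
  moreover have "smooth_on (f ` S') (inv_into S f)"
    using assms T by (auto simp: diffeomorphism_on_def intro: smooth_on_subset)
  ultimately have "smooth_on (f ` S') (inv_into S' f)"
    using smooth_on_cong[OF assms(3)] by blast
  then show ?thesis
    using assms inj_on_subset[OF f]
    by (auto simp: diffeomorphism_on_def inj_on_imp_bij_betw intro: smooth_on_subset)
qed

section \<open>Frame bundles and realization of jets by deformations\<close>

lemma bounded_bilinear_matrix_mult:
  "bounded_bilinear ((**) :: real ^ 'n ^ 'm \<Rightarrow> real ^ 'k ^ 'n \<Rightarrow> real ^ 'k ^ 'm)"
  unfolding bilinear_conv_bounded_bilinear[symmetric] bilinear_def
  by (auto intro!: linearI simp: matrix_matrix_mult_def vec_eq_iff algebra_simps
      sum.distrib sum_distrib_left)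

lemma open_GL: "open (GL :: (real ^ 'n ^ 'n) set)"
proof -
  have "continuous_on UNIV (det :: real ^ 'n ^ 'n \<Rightarrow> real)"
    unfolding det_def by (intro continuous_intros)
  then have "open {A :: real ^ 'n ^ 'n. det A \<noteq> 0}"
    by (intro open_Collect_neq) auto
  then show ?thesis
    by (simp add: GL_def invertible_det_nz)
qed

lemma open_frame_bundle: "open U \<Longrightarrow> open (frame_bundle U)"
  by (simp add: frame_bundle_def open_Times open_GL)

lemma mem_frame_bundle: "X \<in> frame_bundle U \<longleftrightarrow> fst X \<in> U \<and> snd X \<in> GL"
  by (cases X) (simp add: frame_bundle_def)

lemma mat_1_GL [simp]: "mat 1 \<in> GL"
  by (simp add: GL_def invertible_det_nz)

lemma GL_mult: "A \<in> GL \<Longrightarrow> B \<in> GL \<Longrightarrow> A ** B \<in> GL"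
  by (simp add: GL_def invertible_mult)

lemma GL_left_cancel: "A \<in> GL \<Longrightarrow> A ** B = A ** C \<longleftrightarrow> B = C"
  unfolding GL_def by (metis invertible_def matrix_mul_assoc matrix_mul_lid mem_Collect_eq)

lemma GL_vec_cancel: "A \<in> GL \<Longrightarrow> A *v x = A *v y \<longleftrightarrow> x = y"
  unfolding GL_def
  by (metis invertible_def matrix_vector_mul_assoc matrix_vector_mul_lid mem_Collect_eq)

text \<open>Together with \<open>base_map\<close> this gives the normal form (u, G) -> (\<psi> u,
  \<Phi> u ** G) of an equivariant map: \<Phi> u is read off at the identity frame.\<close>

definition fibre_map :: "('n::finite frame \<Rightarrow> 'n frame) \<Rightarrow> real ^ 'n \<Rightarrow> real ^ 'n ^ 'n" where
  "fibre_map \<Psi> x = snd (\<Psi> (x, mat 1))"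

lemma equivariant_on_apply:
  assumes "equivariant_on U F" "u \<in> U" "G \<in> GL"
  shows "F (u, G) = (base_map F u, fibre_map F u ** G)"
proof -
  have "F (frame_act (u, mat 1) G) = frame_act (F (u, mat 1)) G"
    using assms by (simp add: equivariant_on_def frame_bundle_def)
  then show ?thesis
    by (simp add: frame_act_def base_map_def fibre_map_def)
qed

text \<open>An equivariant map is determined by its values on the section u -> (u, I). Hence the
  derivative \<open>D\<close> at the single frame over \<open>y\<close> with matrix I determines the
  derivatives along the whole fibre, by the product rule for \<Phi> u ** G.\<close>

lemma equivariant_on_has_derivative:
  fixes F :: "'n::finite frame \<Rightarrow> 'n frame"
  assumes F: "equivariant_on U F" and "open U" "y \<in> U" "G \<in> GL"
    and D: "(F has_derivative D) (at (y, mat 1))"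
  shows "(F has_derivative (\<lambda>(a, b). (fst (D (a, 0)), snd (D (a, 0)) ** G + fibre_map F y ** b)))
           (at (y, G))"
proof -
  have sec: "((\<lambda>u. F (u, mat 1)) has_derivative (\<lambda>a. D (a, 0))) (at y)"
    by (rule has_derivative_compose[of "\<lambda>u. (u, mat 1)" "\<lambda>a. (a, 0)" y UNIV F D])
      (use D in \<open>auto intro!: derivative_eq_intros\<close>)
  have at_fst: "((\<lambda>X. F (fst X, mat 1)) has_derivative (\<lambda>X. D (fst X, 0))) (at (y, G))"
    by (rule has_derivative_compose[of fst fst "(y, G)" UNIV "\<lambda>u. F (u, mat 1)" "\<lambda>a. D (a, 0)"])
      (use sec in \<open>auto intro!: derivative_eq_intros\<close>)
  have "((\<lambda>X. (base_map F (fst X), fibre_map F (fst X) ** snd X)) has_derivative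
      (\<lambda>X. (fst (D (fst X, 0)), fibre_map F y ** snd X + snd (D (fst X, 0)) ** G))) (at (y, G))"
    unfolding base_map_def fibre_map_def
    by (intro has_derivative_Pair has_derivative_fst at_fst
        bounded_bilinear.FDERIV[OF bounded_bilinear_matrix_mult, THEN has_derivative_eq_rhs]
        has_derivative_snd has_derivative_ident) (auto intro!: at_fst derivative_eq_intros)
  \<comment> \<open>The normal form is known to equal \<open>F\<close> only over \<open>U\<close>;
    as \<open>frame_bundle U\<close> is open, this suffices to transfer the derivative.\<close>
  moreover have "(base_map F (fst X), fibre_map F (fst X) ** snd X) = F X" if "X \<in> frame_bundle U" for X
    using equivariant_on_apply[OF F, of "fst X" "snd X"] that by (simp add: mem_frame_bundle)
  ultimately have "(F has_derivative
      (\<lambda>X. (fst (D (fst X, 0)), fibre_map F y ** snd X + snd (D (fst X, 0)) ** G))) (at (y, G))"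
    using assms open_frame_bundle
    by (elim has_derivative_transform_within_open[where s = "frame_bundle U"])
      (auto simp: mem_frame_bundle)
  then show ?thesis
    by (simp add: case_prod_unfold add.commute)
qed

text \<open>The perturbation has norm at most \<open>e t / (1 + t\<^sup>2) < e\<close>, where \<open>t = c |v| / e\<close> and \<open>K = (c / e)\<^sup>2\<close>.\<close>

lemma bounded_linear_section_into_GL:
  fixes C :: "'a::real_inner \<Rightarrow> real ^ 'n ^ 'n"
  assumes "P \<in> GL" and C: "bounded_linear C"
  obtains K where "K \<ge> 0" "\<And>v. P + inverse (1 + K * (v \<bullet> v)) *\<^sub>R C v \<in> GL"
proof -
  obtain e where e: "e > 0" "ball P e \<subseteq> GL"
    using open_GL \<open>P \<in> GL\<close> open_contains_ball by blast
  obtain c where c: "c > 0" "\<And>v. norm (C v) \<le> norm v * c"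
    using bounded_linear.pos_bounded[OF C] by blast
  let ?K = "(c / e)\<^sup>2"
  have "P + inverse (1 + ?K * (v \<bullet> v)) *\<^sub>R C v \<in> GL" for v
  proof -
    define t where "t = c * norm v / e"
    have Kt: "?K * (v \<bullet> v) = t\<^sup>2"
      by (simp add: t_def power2_norm_eq_inner[symmetric] power_divide power_mult_distrib)
    have "2 * t \<le> 1 + t\<^sup>2"
      using zero_le_power2[of "t - 1"] by (simp add: power2_diff)
    then have "t < 1 + t\<^sup>2"
      using zero_le_power2[of t] by linarith
    have pos: "1 + t\<^sup>2 > 0"
      using zero_le_power2[of t] by linarith
    have "norm (inverse (1 + ?K * (v \<bullet> v)) *\<^sub>R C v) = norm (C v) / (1 + t\<^sup>2)"
      unfolding Kt using pos by (simp add: divide_inverse mult.commute)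
    also have "\<dots> \<le> (e * t) / (1 + t\<^sup>2)"
      using c(2)[of v] e(1) pos by (simp add: t_def divide_right_mono mult.commute)
    also have "\<dots> < e"
      using \<open>t < 1 + t\<^sup>2\<close> e(1) pos by (simp add: pos_divide_less_eq)
    finally show ?thesis
      using e(2) by (simp add: subset_iff dist_norm)
  qed
  then show ?thesis
    using that[of ?K] by simp
qed

text \<open>The affine base part and left multiplication by the invertible matrices \<Phi> u are
  injective, which makes the map and all its derivatives injective. Damping keeps \<Phi> u
  invertible far from \<open>y\<close> without changing the 1-jets over \<open>y\<close>.\<close>

lemma deformation_with_jet:
  fixes A P :: "real ^ 'n ^ 'n" and C :: "real ^ 'n \<Rightarrow> real ^ 'n ^ 'n" and y z :: "real ^ 'n"
  assumes "open M" "A \<in> GL" "P \<in> GL" and C: "bounded_linear C"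
  obtains \<kappa> where "deformation M \<kappa>" "\<And>G. \<kappa> (y, G) = (z, P ** G)"
    "\<And>G. (\<kappa> has_derivative (\<lambda>(a, b). (A *v a, C a ** G + P ** b))) (at (y, G))"
proof -
  obtain K where K: "K \<ge> 0" "\<And>v. P + inverse (1 + K * (v \<bullet> v)) *\<^sub>R C v \<in> GL"
    using bounded_linear_section_into_GL[OF \<open>P \<in> GL\<close> C] by blast
  define \<Phi> where "\<Phi> u = P + inverse (1 + K * ((u - y) \<bullet> (u - y))) *\<^sub>R C (u - y)" for u
  define \<kappa> where "\<kappa> X = (z + A *v (fst X - y), \<Phi> (fst X) ** snd X)" for X :: "'n frame"
  have GL: "\<Phi> u \<in> GL" for u
    using K(2) by (simp add: \<Phi>_def)
  have nz: "1 + K * (v \<bullet> v) \<noteq> 0" for v :: "real ^ 'n"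
    using mult_nonneg_nonneg[OF K(1) inner_ge_zero[of v]] by linarith
  have Ck_\<Phi>: "Ck_on k UNIV \<Phi>" for k
    unfolding \<Phi>_def diff_conv_add_uminus using nz[of "_ + - y"]
    by (intro Ck_on_add Ck_on_const Ck_on_bilinear[OF bounded_bilinear_scaleR] Ck_on_inverse
        Ck_on_bilinear[OF bounded_bilinear_mult] Ck_on_bilinear[OF bounded_bilinear_inner]
        Ck_on_bounded_linear[OF C] Ck_on_ident open_UNIV) auto
  have "Ck_on k UNIV \<kappa>" for k
    unfolding \<kappa>_def diff_conv_add_uminus
    by (intro Ck_on_Pair Ck_on_add Ck_on_const open_UNIV subset_UNIV
        Ck_on_bounded_linear[OF matrix_vector_mul_bounded_linear]
        Ck_on_bilinear[OF bounded_bilinear_matrix_mult] Ck_on_compose[OF _ _ _ _ Ck_\<Phi>]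
        Ck_on_bounded_linear[OF bounded_linear_fst] Ck_on_bounded_linear[OF bounded_linear_snd]
        Ck_on_ident)
  then have smooth: "smooth_on UNIV \<kappa>"
    by (simp add: smooth_on_def)
  \<comment> \<open>Stated for an arbitrary derivative of \<Phi> at an arbitrary point: the
    immersion property uses it everywhere with an unspecified \<Phi>', the prescribed jet uses it at
    \<open>y\<close> with \<open>C\<close>.\<close>
  have \<kappa>': "(\<kappa> has_derivative (\<lambda>(a, b). (A *v a, \<Phi>' a ** G + \<Phi> u ** b))) (at (u, G))"
    if "(\<Phi> has_derivative \<Phi>') (at u)" for u G \<Phi>'
  proof -
    have 1: "((\<lambda>X. \<Phi> (fst X)) has_derivative (\<lambda>X. \<Phi>' (fst X))) (at (u, G))"
      by (rule has_derivative_compose[of fst fst "(u, G)" UNIV \<Phi> \<Phi>'])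
        (use that in \<open>auto intro!: derivative_eq_intros\<close>)
    have "(\<kappa> has_derivative (\<lambda>X. (A *v fst X, \<Phi> u ** snd X + \<Phi>' (fst X) ** G))) (at (u, G))"
      unfolding \<kappa>_def
      by (intro has_derivative_Pair 1
          bounded_bilinear.FDERIV[OF bounded_bilinear_matrix_mult, THEN has_derivative_eq_rhs])
        (auto intro!: 1 derivative_eq_intros
          bounded_linear.has_derivative[OF matrix_vector_mul_bounded_linear])
    then show ?thesis
      by (simp add: case_prod_unfold add.commute)
  qed
  have inj': "inj (frechet_derivative \<kappa> (at X))" for X
  proof (cases X)
    case (Pair u G)
    let ?D = "frechet_derivative \<kappa> (at (u, G))"
    have D: "(\<kappa> has_derivative ?D) (at (u, G))"
      by (rule smooth_on_has_derivative[OF smooth]) simp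
    have "\<Phi> differentiable (at u)"
      using Ck_on_Suc_has_derivative[OF Ck_\<Phi>] by (auto simp: differentiable_def)
    then obtain \<Phi>' where "(\<Phi> has_derivative \<Phi>') (at u)"
      by (auto simp: differentiable_def)
    then have \<Phi>': "linear \<Phi>'" and D_eq: "?D = (\<lambda>(a, b). (A *v a, \<Phi>' a ** G + \<Phi> u ** b))"
      using has_derivative_unique[OF D \<kappa>'] by (auto intro: has_derivative_linear)
    \<comment> \<open>The derivative is block triangular: for a kernel vector (a, b), A a = 0 forces
      a = 0, and then \<Phi> u ** b = 0 forces b = 0.\<close>
    have "inj ?D"
      unfolding linear_injective_0[OF has_derivative_linear[OF D]] unfolding D_eq
      using GL_vec_cancel[OF \<open>A \<in> GL\<close>, of _ 0] GL_left_cancel[OF GL, of u _ 0] linear_0[OF \<Phi>']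
      by (auto simp: zero_prod_def)
    with Pair show ?thesis by simp
  qed
  have "inj \<kappa>"
    by (auto intro!: injI simp: \<kappa>_def GL_vec_cancel[OF \<open>A \<in> GL\<close>] GL_left_cancel[OF GL] prod_eq_iff)
  \<comment> \<open>Source and target have the same dimension, so invariance of domain turns
    continuity and injectivity into a homeomorphism onto the image.\<close>
  then have "\<exists>g. homeomorphism (frame_bundle M) (\<kappa> ` frame_bundle M) \<kappa> g"
    using invariance_of_domain_homeomorphism[OF open_frame_bundle[OF \<open>open M\<close>], of \<kappa>]
      continuous_on_subset[OF smooth_on_continuous[OF smooth]] inj_on_subset[of \<kappa> UNIV]
    by (metis order_refl subset_UNIV)
  then have "deformation M \<kappa>"
    using inj' smooth_on_subset[OF smooth] GL
    by (auto simp: deformation_def smooth_embedding_on_def equivariant_on_def frame_act_def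
        mem_frame_bundle \<kappa>_def GL_mult matrix_mul_assoc)
  moreover have "\<kappa> (y, G) = (z, P ** G)" for G
    using linear_0[OF bounded_linear.linear[OF C]] by (simp add: \<kappa>_def \<Phi>_def)
  moreover have "(\<kappa> has_derivative (\<lambda>(a, b). (A *v a, C a ** G + P ** b))) (at (y, G))" for G
  proof -
    \<comment> \<open>In the product rule the derivative of the damping factor multiplies C 0 = 0,
      and the factor itself is 1 at \<open>y\<close>.\<close>
    have "(\<Phi> has_derivative C) (at y)"
      unfolding \<Phi>_def using nz[of 0] linear_0[OF bounded_linear.linear[OF C]]
      by (auto intro!: derivative_eq_intros bounded_linear.has_derivative[OF C])
    from \<kappa>'[OF this] show ?thesis
      using linear_0[OF bounded_linear.linear[OF C]] by (simp add: \<Phi>_def)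
  qed
  ultimately show ?thesis
    by (rule that)
qed

section \<open>From locally defined equivariant maps to infinitesimal deformations\<close>

lemma jet1_eq: "(F has_derivative D) (at X) \<Longrightarrow> jet1 F X = (X, F X, D)"
  by (simp add: jet1_def frechet_derivative_at[symmetric])

text \<open>An infinitesimal deformation records only 1-jets on the fibre, so a map that is
  equivariant near \<open>y\<close> can be replaced by a global deformation with the same jets. The
  components of \<open>D (a, 0)\<close> supply the data A and C; the point is that injectivity of
  \<open>D\<close> makes A invertible.\<close>

lemma jet_class_in_infinitesimal_deformations:
  fixes F :: "'n::finite frame \<Rightarrow> 'n frame"
  assumes "open M" "open U" "y \<in> U" and F: "equivariant_on U F"
    and P: "fibre_map F y \<in> GL"
    and D: "(F has_derivative D) (at (y, mat 1))" and "inj D"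
  shows "jet_class y F \<in> infinitesimal_deformations M y"
proof -
  define L where "L a = fst (D (a, 0))" for a
  define C where "C a = snd (D (a, 0))" for a
  let ?P = "fibre_map F y"
  have bl: "bounded_linear (\<lambda>a. D (a, 0))"
    by (rule bounded_linear_compose[OF has_derivative_bounded_linear[OF D]])
      (intro bounded_linear_Pair bounded_linear_ident bounded_linear_zero)
  have L: "bounded_linear L" and C: "bounded_linear C"
    unfolding L_def C_def
    by (rule bounded_linear_compose[OF bounded_linear_fst bl]
        bounded_linear_compose[OF bounded_linear_snd bl])+
  have F': "(F has_derivative (\<lambda>(a, b). (L a, C a ** G + ?P ** b))) (at (y, G))" if "G \<in> GL" for G
    using equivariant_on_has_derivative[OF F assms(2,3) that D] by (simp add: L_def C_def)
  have D_eq: "D (a, b) = (L a, C a + ?P ** b)" for a b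
    using has_derivative_unique[OF D F'[OF mat_1_GL]] by simp
  \<comment> \<open>A vertical vector cancels \<open>C a\<close>: with \<open>Q\<close> a right
    inverse of \<open>?P\<close> and b = - Q ** C a, \<open>L a = 0\<close> gives D (a, b) = 0, and
    injectivity of \<open>D\<close> yields a = 0.\<close>
  have "a = 0" if "L a = 0" for a
  proof -
    obtain Q where "?P ** Q = mat 1"
      using P by (auto simp: GL_def invertible_def)
    then have "?P ** (- (Q ** C a)) = - C a"
      using bounded_bilinear.minus_right[OF bounded_bilinear_matrix_mult, of ?P "Q ** C a"]
      by (simp add: matrix_mul_assoc)
    then have "D (a, - (Q ** C a)) = D 0"
      using that linear_0[OF has_derivative_linear[OF D]] by (simp add: D_eq zero_prod_def)
    then show ?thesis
      using injD[OF \<open>inj D\<close>] by (fastforce simp: zero_prod_def)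
  qed
  then have "inj L"
    using linear_injective_0[OF bounded_linear.linear[OF L]] by blast
  then have A: "matrix L \<in> GL"
    using L by (simp add: GL_def invertible_left_inverse matrix_left_invertible_injective
        matrix_vector_mul(3))
  have AL: "matrix L *v a = L a" for a
    using fun_cong[OF matrix_vector_mul(3)[OF L]] .
  obtain \<kappa> where \<kappa>: "deformation M \<kappa>" "\<And>G. \<kappa> (y, G) = (base_map F y, ?P ** G)"
    "\<And>G. (\<kappa> has_derivative (\<lambda>(a, b). (matrix L *v a, C a ** G + ?P ** b))) (at (y, G))"
    using deformation_with_jet[OF \<open>open M\<close> A P C] by blast
  \<comment> \<open>A class is the image of the whole fibre, so the jets are matched at every frame
    over \<open>y\<close>, not only at the identity frame.\<close>
  have "jet1 \<kappa> X = jet1 F X" if fibre: "X \<in> frame_bundle {y}" for X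
  proof -
    obtain G where X: "X = (y, G)" "G \<in> GL"
      using fibre by (auto simp: frame_bundle_def)
    have "jet1 \<kappa> X = (X, \<kappa> X, (\<lambda>(a, b). (matrix L *v a, C a ** G + ?P ** b)))"
      unfolding X by (rule jet1_eq[OF \<kappa>(3)])
    moreover have "jet1 F X = (X, F X, (\<lambda>(a, b). (L a, C a ** G + ?P ** b)))"
      unfolding X by (rule jet1_eq[OF F'[OF X(2)]])
    ultimately show ?thesis
      using \<kappa>(2) equivariant_on_apply[OF F \<open>y \<in> U\<close> X(2)] by (simp add: X AL)
  qed
  then have "jet_class y \<kappa> = jet_class y F"
    by (simp add: jet_class_def)
  with \<kappa>(1) show ?thesis
    by (auto simp: infinitesimal_deformations_def)
qed

section \<open>Jets of local bundle isomorphisms\<close>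

lemma frame_bundle_fibre_nonempty: "frame_bundle {x} \<noteq> {}"
proof -
  have "(x, mat 1) \<in> frame_bundle {x}"
    by (simp add: frame_bundle_def)
  then show ?thesis by blast
qed

text \<open>The projection is constant on the class and the fibre is nonempty, so
  \<open>the_elem\<close> is applied to a genuine singleton.\<close>

lemma jet_source_jet_class: "jet_source (jet_class x \<Psi>) = x"
proof -
  have "(\<lambda>(X, Y, L). fst X) ` jet_class x \<Psi> = (\<lambda>X. x) ` frame_bundle {x}"
    unfolding jet_class_def image_image
    by (rule image_cong) (auto simp: jet1_def mem_frame_bundle)
  then show ?thesis
    by (simp add: jet_source_def image_constant_conv frame_bundle_fibre_nonempty)
qed

lemma jet_target_jet_class:
  assumes "equivariant_on U \<Psi>" "x \<in> U"
  shows "jet_target (jet_class x \<Psi>) = base_map \<Psi> x"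
proof -
  have "(\<lambda>(X, Y, L). fst Y) ` jet_class x \<Psi> = (\<lambda>X. base_map \<Psi> x) ` frame_bundle {x}"
    unfolding jet_class_def image_image using equivariant_on_apply[OF assms]
    by (intro image_cong) (auto simp: jet1_def frame_bundle_def)
  then show ?thesis
    by (simp add: jet_target_def image_constant_conv frame_bundle_fibre_nonempty)
qed

text \<open>Each frame over \<open>x\<close> carries exactly one jet of \<Psi>, and its target frame
  lies over \<open>z\<close>, where exactly one jet of \<kappa> starts. Composing matching jets is
  therefore the chain rule.\<close>

lemma jet_comp_jet_class:
  assumes "\<Psi> ` frame_bundle {x} \<subseteq> frame_bundle {z}"
    and "\<And>X. X \<in> frame_bundle {x} \<Longrightarrow> \<Psi> differentiable (at X)"
    and "\<And>X. X \<in> frame_bundle {x} \<Longrightarrow> \<kappa> differentiable (at (\<Psi> X))"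
  shows "jet_comp (jet_class z \<kappa>) (jet_class x \<Psi>) = jet_class x (\<kappa> \<circ> \<Psi>)"
proof -
  have "jet_class x (\<kappa> \<circ> \<Psi>) = (\<lambda>X. (X, \<kappa> (\<Psi> X),
      frechet_derivative \<kappa> (at (\<Psi> X)) \<circ> frechet_derivative \<Psi> (at X))) ` frame_bundle {x}"
    unfolding jet_class_def using assms
    by (intro image_cong) (simp_all add: jet1_def frechet_derivative_compose)
  also have "\<dots> = jet_comp (jet_class z \<kappa>) (jet_class x \<Psi>)"
    using assms(1) unfolding jet_comp_def jet_class_def jet1_def
    by (intro equalityI subsetI) (fast | blast)+
  finally show ?thesis by (rule sym)
qed

lemma jet_compI: "(X, Y, L) \<in> c \<Longrightarrow> (Y, Z, L') \<in> d \<Longrightarrow> (X, Z, L' \<circ> L) \<in> jet_comp d c"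
  unfolding jet_comp_def by blast

lemma jet_compE:
  assumes "p \<in> jet_comp d c"
  obtains X Y Z L L' where "p = (X, Z, L' \<circ> L)" "(X, Y, L) \<in> c" "(Y, Z, L') \<in> d"
  using assms unfolding jet_comp_def by blast

text \<open>Composition is a relational product carrying composed linear maps, so associativity
  holds for arbitrary sets of jets.\<close>

lemma jet_comp_assoc: "jet_comp k (jet_comp d c) = jet_comp (jet_comp k d) c"
proof (intro equalityI subsetI)
  fix p assume "p \<in> jet_comp k (jet_comp d c)"
  then obtain X Y Z L L' where p: "p = (X, Z, L' \<circ> L)" "(X, Y, L) \<in> jet_comp d c" "(Y, Z, L') \<in> k"
    by (rule jet_compE)
  from p(2) obtain Y' K K' where "L = K' \<circ> K" "(X, Y', K) \<in> c" "(Y', Y, K') \<in> d"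
    by (rule jet_compE) simp
  with p show "p \<in> jet_comp (jet_comp k d) c"
    by (simp only: o_assoc) (intro jet_compI)
next
  fix p assume "p \<in> jet_comp (jet_comp k d) c"
  then obtain X Y Z L L' where p: "p = (X, Z, L' \<circ> L)" "(X, Y, L) \<in> c" "(Y, Z, L') \<in> jet_comp k d"
    by (rule jet_compE)
  from p(3) obtain Y' K K' where "L' = K' \<circ> K" "(Y, Y', K) \<in> d" "(Y', Z, K') \<in> k"
    by (rule jet_compE) simp
  with p show "p \<in> jet_comp k (jet_comp d c)"
    by (simp only: comp_assoc) (intro jet_compI)
qed

lemma jet_comp_identity:
  assumes "\<And>X. X \<in> frame_bundle {x} \<Longrightarrow> \<kappa> differentiable (at X)"
  shows "jet_comp (jet_class x \<kappa>) (jet_identity x) = jet_class x \<kappa>"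
proof -
  have "jet_comp (jet_class x \<kappa>) (jet_identity x) = jet_class x (\<kappa> \<circ> id)"
    unfolding jet_identity_def using assms by (intro jet_comp_jet_class) (auto simp: id_def)
  then show ?thesis by simp
qed

section \<open>Local bundle isomorphisms: base maps, inversion, restriction, composition\<close>

lemma local_bundle_isoD:
  assumes "local_bundle_iso U V \<Psi>"
  shows "open U" "open V" "equivariant_on U \<Psi>"
    "bij_betw \<Psi> (frame_bundle U) (frame_bundle V)"
    "smooth_on (frame_bundle U) \<Psi>"
    "smooth_on (frame_bundle V) (inv_into (frame_bundle U) \<Psi>)"
  using assms by (auto simp: local_bundle_iso_def diffeomorphism_on_def)

lemma local_bundle_iso_base_map:
  assumes "local_bundle_iso U V \<Psi>" "x \<in> U"
  shows "base_map \<Psi> x \<in> V" "fibre_map \<Psi> x \<in> GL"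
    "\<Psi> ` frame_bundle {x} = frame_bundle {base_map \<Psi> x}"
proof -
  note \<Psi> = local_bundle_isoD[OF assms(1)]
  have "\<Psi> (x, mat 1) \<in> frame_bundle V"
    using bij_betwE[OF \<Psi>(4)] assms(2) by (simp add: frame_bundle_def)
  then show "base_map \<Psi> x \<in> V" and P: "fibre_map \<Psi> x \<in> GL"
    by (simp_all add: mem_frame_bundle base_map_def fibre_map_def)
  from P obtain Q where Q: "fibre_map \<Psi> x ** Q = mat 1" "Q ** fibre_map \<Psi> x = mat 1"
    by (auto simp: GL_def invertible_def)
  then have "Q \<in> GL"
    by (auto simp: GL_def invertible_def)
  \<comment> \<open>Surjectivity onto the fibre: the preimage is (x, Q ** G), with \<open>Q\<close>
    the inverse of \<open>fibre_map \<Psi> x\<close>.\<close>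
  have "(base_map \<Psi> x, G) \<in> \<Psi> ` frame_bundle {x}" if "G \<in> GL" for G
    using equivariant_on_apply[OF \<Psi>(3) assms(2) GL_mult[OF \<open>Q \<in> GL\<close> that]] Q(1)
      GL_mult[OF \<open>Q \<in> GL\<close> that]
    by (intro image_eqI[where x = "(x, Q ** G)"]) (auto simp: mem_frame_bundle matrix_mul_assoc)
  then show "\<Psi> ` frame_bundle {x} = frame_bundle {base_map \<Psi> x}"
    using equivariant_on_apply[OF \<Psi>(3) assms(2)] P by (auto simp: frame_bundle_def GL_mult)
qed

lemma local_bundle_iso_inverse:
  assumes "local_bundle_iso U V \<Psi>"
  shows "local_bundle_iso V U (inv_into (frame_bundle U) \<Psi>)"
proof -
  note \<Psi> = local_bundle_isoD[OF assms]
  let ?I = "inv_into (frame_bundle U) \<Psi>"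
  have "?I (frame_act Y g) = frame_act (?I Y) g" if "Y \<in> frame_bundle V" "g \<in> GL" for Y g
  proof -
    have X: "?I Y \<in> frame_bundle U" "\<Psi> (?I Y) = Y"
      using \<Psi>(4) that(1) by (auto simp: bij_betw_def inv_into_into f_inv_into_f)
    have "frame_act (?I Y) g \<in> frame_bundle U"
      using X(1) that(2) by (simp add: mem_frame_bundle frame_act_def GL_mult)
    moreover have "\<Psi> (frame_act (?I Y) g) = frame_act Y g"
      using \<Psi>(3) X that(2) by (simp add: equivariant_on_def)
    ultimately show ?thesis
      using \<Psi>(4) by (metis bij_betw_inv_into_left)
  qed
  then show ?thesis
    using \<Psi> diffeomorphism_on_inverse[OF open_frame_bundle[OF \<Psi>(1)]] assms
    by (simp add: local_bundle_iso_def equivariant_on_def)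
qed

text \<open>\<open>\<Psi> (x, mat 1)\<close> need not be the identity frame over its base point;
  equivariance of the inverse shows that its matrix part does not influence the resulting base
  point.\<close>

lemma local_bundle_iso_base_map_inverse:
  assumes "local_bundle_iso U V \<Psi>" "x \<in> U"
  shows "base_map (inv_into (frame_bundle U) \<Psi>) (base_map \<Psi> x) = x"
proof -
  let ?I = "inv_into (frame_bundle U) \<Psi>"
  have "?I (\<Psi> (x, mat 1)) = (x, mat 1)"
    using local_bundle_isoD(4)[OF assms(1)] assms(2)
    by (simp add: bij_betw_inv_into_left frame_bundle_def)
  moreover have "fst (?I (\<Psi> (x, mat 1))) = base_map ?I (base_map \<Psi> x)"
    using equivariant_on_apply[OF local_bundle_isoD(3)[OF local_bundle_iso_inverse[OF assms(1)]]
        local_bundle_iso_base_map(1)[OF assms] local_bundle_iso_base_map(2)[OF assms]]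
    by (simp add: base_map_def[of \<Psi>] fibre_map_def[of \<Psi>])
  ultimately show ?thesis by simp
qed

lemma continuous_on_base_map:
  assumes "continuous_on (frame_bundle U) \<Psi>"
  shows "continuous_on U (base_map \<Psi>)"
  unfolding base_map_def
  by (intro continuous_on_fst continuous_on_compose2[OF assms] continuous_intros)
    (auto simp: mem_frame_bundle)

text \<open>Used to shrink domains before composing. The base map has a left inverse, so it is
  injective and invariance of domain makes the image of \<open>U'\<close> open; since fibres map
  onto fibres, the restricted bundle maps onto the full bundle over that image.\<close>

lemma local_bundle_iso_restrict:
  assumes "local_bundle_iso U V \<Psi>" "open U'" "U' \<subseteq> U"
  shows "local_bundle_iso U' (base_map \<Psi> ` U') \<Psi>"
proof -
  note \<Psi> = local_bundle_isoD[OF assms(1)]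
  have "continuous_on U' (base_map \<Psi>)"
    using continuous_on_base_map[OF smooth_on_continuous[OF \<Psi>(5)]] assms(3)
    by (rule continuous_on_subset)
  moreover have "inj_on (base_map \<Psi>) U'"
    using local_bundle_iso_base_map_inverse[OF assms(1)] assms(3)
    by (intro inj_on_inverseI[where g = "base_map (inv_into (frame_bundle U) \<Psi>)"]) auto
  ultimately have op: "open (base_map \<Psi> ` U')"
    by (intro invariance_of_domain assms)
  have "frame_bundle U' = (\<Union>x\<in>U'. frame_bundle {x})"
    by (auto simp: frame_bundle_def)
  then have "\<Psi> ` frame_bundle U' = (\<Union>x\<in>U'. frame_bundle {base_map \<Psi> x})"
    using local_bundle_iso_base_map(3)[OF assms(1)] assms(3) by (auto simp: image_UN subset_iff)
  then have im: "\<Psi> ` frame_bundle U' = frame_bundle (base_map \<Psi> ` U')"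
    by (auto simp: frame_bundle_def)
  have "diffeomorphism_on (frame_bundle U') (\<Psi> ` frame_bundle U') \<Psi>"
  proof (rule diffeomorphism_on_restrict)
    show "diffeomorphism_on (frame_bundle U) (frame_bundle V) \<Psi>"
      using assms(1) by (simp add: local_bundle_iso_def)
    show "frame_bundle U' \<subseteq> frame_bundle U"
      using assms(3) by (auto simp: frame_bundle_def)
    show "open (\<Psi> ` frame_bundle U')"
      unfolding im by (rule open_frame_bundle[OF op])
  qed
  then show ?thesis
    using \<Psi>(3) assms op im
    by (auto simp: local_bundle_iso_def equivariant_on_def mem_frame_bundle subset_iff)
qed

lemma local_bundle_iso_compose:
  assumes "local_bundle_iso U V \<Psi>" "local_bundle_iso V V' \<Psi>'"
  shows "local_bundle_iso U V' (\<Psi>' \<circ> \<Psi>)"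
proof -
  note \<Psi> = local_bundle_isoD[OF assms(1)] and \<Psi>' = local_bundle_isoD[OF assms(2)]
  have "diffeomorphism_on (frame_bundle U) (frame_bundle V') (\<Psi>' \<circ> \<Psi>)"
    using assms by (intro diffeomorphism_on_compose[of _ "frame_bundle V"])
      (auto simp: local_bundle_iso_def open_frame_bundle)
  then show ?thesis
    using \<Psi> \<Psi>' bij_betwE[OF \<Psi>(4)] by (simp add: local_bundle_iso_def equivariant_on_def)
qed

section \<open>Derivatives and jets of the inverse isomorphism\<close>

lemma local_bundle_iso_differentiable:
  "local_bundle_iso U V \<Psi> \<Longrightarrow> X \<in> frame_bundle U \<Longrightarrow> \<Psi> differentiable (at X)"
  using smooth_on_has_derivative[OF local_bundle_isoD(5)] differentiable_def by blast

lemma local_bundle_iso_derivative_inverse: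
  assumes "local_bundle_iso U V \<Psi>" "X \<in> frame_bundle U"
  shows "frechet_derivative (inv_into (frame_bundle U) \<Psi>) (at (\<Psi> X)) \<circ> frechet_derivative \<Psi> (at X) = id"
proof -
  let ?I = "inv_into (frame_bundle U) \<Psi>"
  have "\<Psi> X \<in> frame_bundle V"
    using local_bundle_isoD(4)[OF assms(1)] assms(2) by (auto simp: bij_betw_def)
  then have "?I differentiable (at (\<Psi> X))"
    by (rule local_bundle_iso_differentiable[OF local_bundle_iso_inverse[OF assms(1)]])
  then have "frechet_derivative ?I (at (\<Psi> X)) \<circ> frechet_derivative \<Psi> (at X)
      = frechet_derivative (?I \<circ> \<Psi>) (at X)"
    using frechet_derivative_compose local_bundle_iso_differentiable[OF assms] by metis
  \<comment> \<open>The composite is the identity on the open set \<open>frame_bundle U\<close>,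
    which determines its derivative at \<open>X\<close>.\<close>
  also have "\<dots> = frechet_derivative id (at X)"
    using assms local_bundle_isoD[OF assms(1)]
    by (intro frechet_derivative_transform_within_open[symmetric, where X = "frame_bundle U"])
      (auto simp: open_frame_bundle bij_betw_inv_into_left id_def)
  finally show ?thesis by simp
qed

text \<open>\<open>inv\<close> of a derivative is identified through a two-sided inverse. One
  cancellation identity comes from \<Psi>, the other from applying the same lemma to the inverse
  isomorphism.\<close>

lemma jet_inverse_jet_class:
  assumes "local_bundle_iso U V \<Psi>" "x \<in> U"
  shows "jet_inverse (jet_class x \<Psi>) = jet_class (base_map \<Psi> x) (inv_into (frame_bundle U) \<Psi>)"
proof -
  let ?I = "inv_into (frame_bundle U) \<Psi>"
  note \<Psi> = local_bundle_isoD[OF assms(1)]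
  have "(\<Psi> X, X, inv (frechet_derivative \<Psi> (at X))) = jet1 ?I (\<Psi> X)"
    if "X \<in> frame_bundle {x}" for X
  proof -
    have X: "X \<in> frame_bundle U"
      using that assms(2) by (auto simp: frame_bundle_def)
    then have IX: "?I (\<Psi> X) = X" "\<Psi> X \<in> frame_bundle V"
      using \<Psi>(4) by (auto simp: bij_betw_def)
    have "inv_into (frame_bundle V) ?I X = \<Psi> X"
      using inv_into_inv_into_eq[OF \<Psi>(4) X] .
    \<comment> \<open>The double \<open>inv_into\<close> is compared with \<Psi> on the open bundle
      over \<open>U\<close>, which is enough for equality of derivatives.\<close>
    moreover have "frechet_derivative (inv_into (frame_bundle V) ?I) (at X) = frechet_derivative \<Psi> (at X)"
      using local_bundle_iso_differentiable[OF assms(1) X] inv_into_inv_into_eq[OF \<Psi>(4)] X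
      by (intro frechet_derivative_transform_within_open[symmetric, where X = "frame_bundle U"])
        (auto simp: open_frame_bundle \<Psi>(1))
    ultimately have "frechet_derivative \<Psi> (at X) \<circ> frechet_derivative ?I (at (\<Psi> X)) = id"
      using local_bundle_iso_derivative_inverse[OF local_bundle_iso_inverse[OF assms(1)] IX(2)] IX(1)
      by simp
    then have "inv (frechet_derivative \<Psi> (at X)) = frechet_derivative ?I (at (\<Psi> X))"
      using local_bundle_iso_derivative_inverse[OF assms(1) X] by (rule inv_unique_comp)
    then show ?thesis
      by (simp add: jet1_def IX)
  qed
  then have "jet_inverse (jet_class x \<Psi>) = jet1 ?I ` \<Psi> ` frame_bundle {x}"
    by (force simp: jet_inverse_def jet_class_def jet1_def image_iff)
  then show ?thesis
    by (simp add: jet_class_def local_bundle_iso_base_map(3)[OF assms])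
qed

lemma jet_comp_inverse_left:
  assumes "local_bundle_iso U V \<Psi>" "x \<in> U"
  shows "jet_comp (jet_inverse (jet_class x \<Psi>)) (jet_class x \<Psi>) = jet_identity x"
proof -
  let ?I = "inv_into (frame_bundle U) \<Psi>"
  note \<Psi> = local_bundle_isoD[OF assms(1)]
  have sub: "X \<in> frame_bundle U" "\<Psi> X \<in> frame_bundle V" if "X \<in> frame_bundle {x}" for X
    using that assms(2) bij_betwE[OF \<Psi>(4)] by (auto simp: frame_bundle_def)
  have "jet_comp (jet_inverse (jet_class x \<Psi>)) (jet_class x \<Psi>) = jet_class x (?I \<circ> \<Psi>)"
    unfolding jet_inverse_jet_class[OF assms]
    using local_bundle_iso_base_map(3)[OF assms] sub
      local_bundle_iso_differentiable[OF assms(1)]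
      local_bundle_iso_differentiable[OF local_bundle_iso_inverse[OF assms(1)]]
    by (intro jet_comp_jet_class) auto
  also have "\<dots> = jet_class x id"
    unfolding jet_class_def
  proof (rule image_cong[OF refl])
    fix X assume X: "X \<in> frame_bundle {x}"
    have "frechet_derivative (?I \<circ> \<Psi>) (at X)
        = frechet_derivative ?I (at (\<Psi> X)) \<circ> frechet_derivative \<Psi> (at X)"
      using sub[OF X] local_bundle_iso_differentiable[OF assms(1)]
        local_bundle_iso_differentiable[OF local_bundle_iso_inverse[OF assms(1)]]
      by (intro frechet_derivative_compose) auto
    then show "jet1 (?I \<circ> \<Psi>) X = jet1 id X"
      using local_bundle_iso_derivative_inverse[OF assms(1)] sub(1)[OF X] \<Psi>(4)
      by (simp add: jet1_def bij_betw_inv_into_left)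
  qed
  finally show ?thesis by (simp add: jet_identity_def)
qed

section \<open>Stability of infinitesimal deformations under local isomorphisms\<close>

lemma deformation_differentiable:
  "deformation M \<kappa> \<Longrightarrow> X \<in> frame_bundle M \<Longrightarrow> \<kappa> differentiable (at X)"
  unfolding deformation_def smooth_embedding_on_def
  using smooth_on_has_derivative differentiable_def by blast

text \<open>The composite \<kappa> \<circ> \<Psi> is controlled only over \<open>U\<close>, so it is
  not itself offered as a deformation of the body. It is equivariant there, with invertible fibre
  component and injective derivative at \<open>x\<close>, so its class is realized by a global
  deformation.\<close>

lemma jet_comp_in_infinitesimal_deformations:
  assumes "open M" and iso: "local_bundle_iso U V \<Psi>" "V \<subseteq> M" "x \<in> U"
    and k: "k \<in> infinitesimal_deformations M (base_map \<Psi> x)"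
  shows "jet_comp k (jet_class x \<Psi>) \<in> infinitesimal_deformations M x"
proof -
  obtain \<kappa> where k_eq: "k = jet_class (base_map \<Psi> x) \<kappa>" and \<kappa>: "deformation M \<kappa>"
    using k by (auto simp: infinitesimal_deformations_def)
  note \<Psi> = local_bundle_isoD[OF iso(1)]
  have into: "\<Psi> X \<in> frame_bundle M" if "X \<in> frame_bundle U" for X
    using bij_betwE[OF \<Psi>(4)] that iso(2) mem_frame_bundle by blast
  have sub: "X \<in> frame_bundle U" if "X \<in> frame_bundle {x}" for X
    using that iso(3) by (auto simp: frame_bundle_def)
  have "jet_comp k (jet_class x \<Psi>) = jet_class x (\<kappa> \<circ> \<Psi>)"
    unfolding k_eq using local_bundle_iso_base_map(3)[OF iso(1,3)]
    by (intro jet_comp_jet_class)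
      (auto intro: local_bundle_iso_differentiable[OF iso(1)] deformation_differentiable[OF \<kappa>] into sub)
  moreover have "jet_class x (\<kappa> \<circ> \<Psi>) \<in> infinitesimal_deformations M x"
  proof -
    let ?X = "(x, mat 1)"
    let ?D = "frechet_derivative \<kappa> (at (\<Psi> ?X)) \<circ> frechet_derivative \<Psi> (at ?X)"
    have X: "?X \<in> frame_bundle U"
      using iso(3) by (simp add: frame_bundle_def)
    have "(\<kappa> \<circ> \<Psi> has_derivative ?D) (at ?X)"
      using local_bundle_iso_differentiable[OF iso(1) X] deformation_differentiable[OF \<kappa> into[OF X]]
      by (intro diff_chain_at) (simp_all add: frechet_derivative_works[symmetric])
    moreover have "inj ?D"
    proof (rule inj_compose)
      show "inj (frechet_derivative \<kappa> (at (\<Psi> ?X)))"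
        using \<kappa> into[OF X] by (simp add: deformation_def smooth_embedding_on_def)
      \<comment> \<open>The derivative of the inverse isomorphism is a left inverse.\<close>
      show "inj (frechet_derivative \<Psi> (at ?X))"
        using local_bundle_iso_derivative_inverse[OF iso(1) X] by (metis inj_on_id inj_on_imageI2)
    qed
    moreover have "equivariant_on U (\<kappa> \<circ> \<Psi>)"
      using \<kappa> \<Psi>(3) into by (simp add: deformation_def equivariant_on_def)
    moreover have "fibre_map (\<kappa> \<circ> \<Psi>) x \<in> GL"
      using \<kappa> into[OF X] by (auto simp: deformation_def fibre_map_def mem_frame_bundle image_subset_iff)
    ultimately show ?thesis
      by (intro jet_class_in_infinitesimal_deformations[OF \<open>open M\<close> \<Psi>(1) iso(3)])
  qed
  ultimately show ?thesis by simp
qed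

section \<open>Groupoid operations on classes of local isomorphisms\<close>

lemma nonholonomic_groupoidE:
  assumes "c \<in> nonholonomic_groupoid M"
  obtains x \<Psi> U V where "c = jet_class x \<Psi>" "local_bundle_iso U V \<Psi>" "U \<subseteq> M" "V \<subseteq> M" "x \<in> U"
    "jet_source c = x" "jet_target c = base_map \<Psi> x" "x \<in> M" "base_map \<Psi> x \<in> M"
proof -
  obtain x \<Psi> U V where *: "c = jet_class x \<Psi>" "local_bundle_iso U V \<Psi>" "U \<subseteq> M" "V \<subseteq> M" "x \<in> U"
    using assms unfolding nonholonomic_groupoid_def by blast
  have "jet_source c = x" "jet_target c = base_map \<Psi> x" "x \<in> M" "base_map \<Psi> x \<in> M"
    using * local_bundle_iso_base_map(1)[OF *(2,5)] jet_source_jet_class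
      jet_target_jet_class[OF local_bundle_isoD(3)[OF *(2)] *(5)] by auto
  with * show ?thesis by (rule that)
qed

lemma jet_identity_in_nonholonomic_groupoid:
  assumes "open M" "x \<in> M"
  shows "jet_identity x \<in> nonholonomic_groupoid M"
proof -
  have id: "smooth_on (frame_bundle M) id"
    unfolding smooth_on_def id_def using Ck_on_ident[OF open_frame_bundle[OF \<open>open M\<close>]] by blast
  have "id X = inv_into (frame_bundle M) id X" if "X \<in> frame_bundle M" for X
    using inv_into_f_f[OF inj_on_id that] by simp
  with id have "smooth_on (frame_bundle M) (inv_into (frame_bundle M) id)"
    using smooth_on_cong[OF open_frame_bundle[OF \<open>open M\<close>]] by blast
  with id have "local_bundle_iso M M id"
    using \<open>open M\<close> by (simp add: local_bundle_iso_def diffeomorphism_on_def equivariant_on_def)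
  then show ?thesis
    using \<open>x \<in> M\<close> unfolding nonholonomic_groupoid_def jet_identity_def by blast
qed

lemma jet_comp_in_nonholonomic_groupoid:
  assumes c: "c \<in> nonholonomic_groupoid M" and d: "d \<in> nonholonomic_groupoid M"
    and st: "jet_source d = jet_target c"
  shows "jet_comp d c \<in> nonholonomic_groupoid M" "jet_source (jet_comp d c) = jet_source c"
    "jet_target (jet_comp d c) = jet_target d"
proof -
  obtain x \<Psi> U V where c: "c = jet_class x \<Psi>" "local_bundle_iso U V \<Psi>" "U \<subseteq> M" "V \<subseteq> M" "x \<in> U"
    "jet_source c = x" "jet_target c = base_map \<Psi> x" "x \<in> M" "base_map \<Psi> x \<in> M"
    by (rule nonholonomic_groupoidE[OF c])
  obtain y \<Psi>' U' V' where d: "d = jet_class y \<Psi>'" "local_bundle_iso U' V' \<Psi>'" "U' \<subseteq> M" "V' \<subseteq> M"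
    "y \<in> U'" "jet_source d = y" "jet_target d = base_map \<Psi>' y" "y \<in> M" "base_map \<Psi>' y \<in> M"
    by (rule nonholonomic_groupoidE[OF d])
  have y: "y = base_map \<Psi> x"
    using st c d by simp
  note \<Psi> = local_bundle_isoD[OF c(2)] and \<Psi>' = local_bundle_isoD[OF d(2)]
  \<comment> \<open>The image \<open>V\<close> of \<Psi> and the domain \<open>U'\<close> of \<Psi>'
    need not match. Over \<open>U1\<close> the composite makes sense, and both factors restrict to
    isomorphisms onto open images.\<close>
  define U1 where "U1 = {u \<in> U. base_map \<Psi> u \<in> U'}"
  have "open (U \<inter> base_map \<Psi> -` U')"
    using continuous_on_base_map[OF smooth_on_continuous[OF \<Psi>(5)]] \<Psi>(1) \<Psi>'(1)
    by (rule continuous_open_preimage)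
  moreover have "U \<inter> base_map \<Psi> -` U' = U1"
    by (auto simp: U1_def)
  ultimately have iso1: "local_bundle_iso U1 (base_map \<Psi> ` U1) \<Psi>"
    by (intro local_bundle_iso_restrict[OF c(2)]) (auto simp: U1_def)
  have sub: "base_map \<Psi> ` U1 \<subseteq> U'"
    by (auto simp: U1_def)
  have iso: "local_bundle_iso U1 (base_map \<Psi>' ` base_map \<Psi> ` U1) (\<Psi>' \<circ> \<Psi>)"
    using local_bundle_isoD(2)[OF iso1] sub
    by (intro local_bundle_iso_compose[OF iso1] local_bundle_iso_restrict[OF d(2)])
  have "x \<in> U1"
    using c d y by (simp add: U1_def)
  have eq: "jet_comp d c = jet_class x (\<Psi>' \<circ> \<Psi>)"
    unfolding c(1) d(1) y
  proof (rule jet_comp_jet_class)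
    show "\<Psi> ` frame_bundle {x} \<subseteq> frame_bundle {base_map \<Psi> x}"
      using local_bundle_iso_base_map(3)[OF c(2,5)] by simp
    fix X assume X: "X \<in> frame_bundle {x}"
    then show "\<Psi> differentiable (at X)"
      using c(5) by (intro local_bundle_iso_differentiable[OF c(2)]) (auto simp: mem_frame_bundle)
    have "\<Psi> X \<in> frame_bundle {y}"
      using local_bundle_iso_base_map(3)[OF c(2,5)] X y by auto
    then show "\<Psi>' differentiable (at (\<Psi> X))"
      using d(5) by (intro local_bundle_iso_differentiable[OF d(2)]) (auto simp: mem_frame_bundle)
  qed
  have "base_map \<Psi>' ` base_map \<Psi> ` U1 \<subseteq> M" "U1 \<subseteq> M"
    using local_bundle_iso_base_map(1)[OF d(2)] sub c(3) d(4) by (auto simp: U1_def)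
  then show "jet_comp d c \<in> nonholonomic_groupoid M"
    unfolding eq nonholonomic_groupoid_def using iso \<open>x \<in> U1\<close> by blast
  show "jet_source (jet_comp d c) = jet_source c"
    unfolding eq c(6) by (rule jet_source_jet_class)
  \<comment> \<open>\<Psi> sends the identity frame at \<open>x\<close> to a frame over
    \<open>y\<close> with matrix \<open>fibre_map \<Psi> x\<close>; by equivariance \<Psi>' has the
    same base point on it as on the identity frame.\<close>
  have "base_map (\<Psi>' \<circ> \<Psi>) x = base_map \<Psi>' y"
    using equivariant_on_apply[OF \<Psi>'(3) d(5) local_bundle_iso_base_map(2)[OF c(2,5)]] y
    by (simp add: base_map_def[of "\<Psi>' \<circ> \<Psi>"] base_map_def[of \<Psi>] fibre_map_def)
  then show "jet_target (jet_comp d c) = jet_target d"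
    using jet_target_jet_class[OF local_bundle_isoD(3)[OF iso] \<open>x \<in> U1\<close>] by (simp add: eq d(7))
qed

lemma jet_inverse_in_nonholonomic_groupoid:
  assumes "c \<in> nonholonomic_groupoid M"
  shows "jet_inverse c \<in> nonholonomic_groupoid M" "jet_target (jet_inverse c) = jet_source c"
    "jet_source (jet_inverse c) = jet_target c"
proof -
  obtain x \<Psi> U V where c: "c = jet_class x \<Psi>" "local_bundle_iso U V \<Psi>" "U \<subseteq> M" "V \<subseteq> M" "x \<in> U"
    "jet_source c = x" "jet_target c = base_map \<Psi> x" "x \<in> M" "base_map \<Psi> x \<in> M"
    by (rule nonholonomic_groupoidE[OF assms])
  let ?I = "inv_into (frame_bundle U) \<Psi>"
  note I = local_bundle_iso_inverse[OF c(2)] and V = local_bundle_iso_base_map(1)[OF c(2,5)]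
  have inv: "jet_inverse c = jet_class (base_map \<Psi> x) ?I"
    unfolding c(1) by (rule jet_inverse_jet_class[OF c(2,5)])
  show "jet_inverse c \<in> nonholonomic_groupoid M"
    unfolding inv nonholonomic_groupoid_def using I V c(3,4) by blast
  show "jet_target (jet_inverse c) = jet_source c"
    using jet_target_jet_class[OF local_bundle_isoD(3)[OF I] V]
      local_bundle_iso_base_map_inverse[OF c(2,5)] by (simp add: inv c(6))
  show "jet_source (jet_inverse c) = jet_target c"
    by (simp add: inv c(7) jet_source_jet_class)
qed

section \<open>The material groupoid and uniformity\<close>

lemma jet_comp_identity_deformation:
  assumes "x \<in> M" "k \<in> infinitesimal_deformations M x"
  shows "jet_comp k (jet_identity x) = k"
proof -
  obtain \<kappa> where "k = jet_class x \<kappa>" "deformation M \<kappa>"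
    using assms(2) by (auto simp: infinitesimal_deformations_def)
  then show ?thesis
    using assms(1) deformation_differentiable[of M \<kappa>] jet_comp_identity[of x \<kappa>]
    by (simp add: mem_frame_bundle)
qed

lemma subgroupoid_material_groupoid:
  fixes M :: "(real ^ 'n::finite) set"
  assumes "open M"
  shows "subgroupoid M M (material_groupoid M W)"
proof -
  let ?\<Omega> = "material_groupoid M W"
  have invD: "extended_response W (jet_comp k c) = extended_response W k"
    if "c \<in> ?\<Omega>" "k \<in> infinitesimal_deformations M (jet_target c)" for c k
    using that by (simp add: material_groupoid_def leaves_invariant_def)
  have comp_def: "jet_comp k c \<in> infinitesimal_deformations M (jet_source c)"
    if c: "c \<in> nonholonomic_groupoid M" and k: "k \<in> infinitesimal_deformations M (jet_target c)" for c k
  proof -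
    obtain x \<Psi> U V where "c = jet_class x \<Psi>" "local_bundle_iso U V \<Psi>" "V \<subseteq> M" "x \<in> U"
      "jet_source c = x" "jet_target c = base_map \<Psi> x"
      by (rule nonholonomic_groupoidE[OF c]) blast
    with k show ?thesis
      using jet_comp_in_infinitesimal_deformations[OF assms] by simp
  qed
  have \<Omega>D: "c \<in> nonholonomic_groupoid M" if "c \<in> ?\<Omega>" for c
    using that by (simp add: material_groupoid_def)
  have "jet_source c \<in> M \<and> jet_target c \<in> M" if "c \<in> ?\<Omega>" for c
    by (rule nonholonomic_groupoidE[OF \<Omega>D[OF that]]) simp
  moreover have "jet_identity x \<in> ?\<Omega>" if x: "x \<in> M" for x
  proof -
    have "jet_target (jet_identity x) = x"
      unfolding jet_identity_def
      using jet_target_jet_class[of M id x] x by (simp add: equivariant_on_def base_map_def)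
    then show ?thesis
      using jet_identity_in_nonholonomic_groupoid[OF assms x] jet_comp_identity_deformation[OF x]
      by (simp add: material_groupoid_def leaves_invariant_def)
  qed
  moreover have "jet_comp d c \<in> ?\<Omega>"
    if cd: "c \<in> ?\<Omega>" "d \<in> ?\<Omega>" "jet_source d = jet_target c" for c d
  proof -
    note dc = jet_comp_in_nonholonomic_groupoid[OF \<Omega>D[OF cd(1)] \<Omega>D[OF cd(2)] cd(3)]
    \<comment> \<open>By associativity W(k(dc)) = W((kd)c) = W(kd) = W(k), writing W for its
      extension. The middle equality tests \<open>c\<close> against kd, an infinitesimal deformation
      at the source of \<open>d\<close>, that is, at the target of \<open>c\<close>.\<close>
    have "extended_response W (jet_comp k (jet_comp d c)) = extended_response W k"
      if k: "k \<in> infinitesimal_deformations M (jet_target d)" for k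
      using invD[OF cd(2) k] invD[OF cd(1), of "jet_comp k d"] comp_def[OF \<Omega>D[OF cd(2)] k] cd(3)
      by (simp add: jet_comp_assoc)
    with dc show ?thesis
      by (simp add: material_groupoid_def leaves_invariant_def)
  qed
  moreover have "jet_inverse c \<in> ?\<Omega>" if c: "c \<in> ?\<Omega>" for c
  proof -
    note ci = jet_inverse_in_nonholonomic_groupoid[OF \<Omega>D[OF c]]
    obtain x \<Psi> U V where c': "c = jet_class x \<Psi>" "local_bundle_iso U V \<Psi>" "x \<in> U"
      "jet_source c = x" "x \<in> M"
      by (rule nonholonomic_groupoidE[OF \<Omega>D[OF c]]) blast
    \<comment> \<open>Here \<open>c\<close> is tested against k composed with its inverse: composing
      further with \<open>c\<close> gives back \<open>k\<close>, so invariance under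
      \<open>c\<close> becomes invariance under the inverse.\<close>
    have "extended_response W (jet_comp k (jet_inverse c)) = extended_response W k"
      if k: "k \<in> infinitesimal_deformations M (jet_source c)" for k
    proof -
      have "jet_comp k (jet_inverse c) \<in> infinitesimal_deformations M (jet_target c)"
        using comp_def[OF ci(1)] k ci by simp
      from invD[OF c this] show ?thesis
        using k c'(4) by (simp add: jet_comp_assoc[symmetric] c'(1) jet_comp_inverse_left[OF c'(2,3)]
            jet_comp_identity_deformation[OF c'(5)])
    qed
    with ci show ?thesis
      by (simp add: material_groupoid_def leaves_invariant_def)
  qed
  ultimately show ?thesis
    using \<Omega>D by (auto simp: subgroupoid_def)
qed

text \<open>One side names an isomorphism, the other its class. The invariance condition depends
  only on the class, and a representative of a class from x to y has y in its image \<open>V\<close>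
  automatically.\<close>

lemma uniform_body_iff_transitive_over:
  "uniform_body M W \<longleftrightarrow> transitive_over M (material_groupoid M W)"
proof
  assume unif: "uniform_body M W"
  show "transitive_over M (material_groupoid M W)"
    unfolding transitive_over_def
  proof (intro ballI)
    fix x y assume "x \<in> M" "y \<in> M"
    then obtain U V \<Psi> where \<Psi>: "local_bundle_iso U V \<Psi>" "U \<subseteq> M" "V \<subseteq> M" "x \<in> U" "base_map \<Psi> x = y"
      and inv: "\<forall>k\<in>infinitesimal_deformations M y.
        extended_response W (jet_comp k (jet_class x \<Psi>)) = extended_response W k"
      using unif unfolding uniform_body_def by meson
    have y: "jet_target (jet_class x \<Psi>) = y"
      using jet_target_jet_class[OF local_bundle_isoD(3)[OF \<Psi>(1)] \<Psi>(4)] \<Psi>(5) by simp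
    have "jet_class x \<Psi> \<in> nonholonomic_groupoid M"
      unfolding nonholonomic_groupoid_def using \<Psi> by blast
    then have "jet_class x \<Psi> \<in> material_groupoid M W"
      using inv y by (simp add: material_groupoid_def leaves_invariant_def)
    then show "\<exists>c\<in>material_groupoid M W. jet_source c = x \<and> jet_target c = y"
      using y jet_source_jet_class by blast
  qed
next
  assume trans: "transitive_over M (material_groupoid M W)"
  show "uniform_body M W"
    unfolding uniform_body_def
  proof (intro ballI)
    fix x y assume "x \<in> M" "y \<in> M"
    then obtain c where c: "c \<in> nonholonomic_groupoid M" "leaves_invariant M W c"
      "jet_source c = x" "jet_target c = y"
      using trans unfolding transitive_over_def material_groupoid_def by blast
    obtain x' \<Psi> U V where "c = jet_class x' \<Psi>" "local_bundle_iso U V \<Psi>" "U \<subseteq> M" "V \<subseteq> M"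
      "x' \<in> U" "jet_source c = x'" "jet_target c = base_map \<Psi> x'"
      by (rule nonholonomic_groupoidE[OF c(1)]) blast
    with c(3,4) have \<Psi>: "c = jet_class x \<Psi>" "local_bundle_iso U V \<Psi>" "U \<subseteq> M" "V \<subseteq> M" "x \<in> U"
      "base_map \<Psi> x = y"
      by simp_all
    have "y \<in> V"
      using local_bundle_iso_base_map(1)[OF \<Psi>(2,5)] \<Psi>(6) by simp
    then show "\<exists>U V \<Psi>. local_bundle_iso U V \<Psi> \<and> U \<subseteq> M \<and> V \<subseteq> M \<and> x \<in> U \<and> y \<in> V \<and>
        base_map \<Psi> x = y \<and>
        (\<forall>k\<in>infinitesimal_deformations M y.
           extended_response W (jet_comp k (jet_class x \<Psi>)) = extended_response W k)"
      using \<Psi> c(2,4) unfolding leaves_invariant_def by blast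
  qed
qed

theorem proposition7p3:
  fixes B :: "(real ^ 3) set"
    and W :: "3 jet set \<Rightarrow> 'v::real_normed_vector"
  assumes "open B"
    and "mechanical_response B W"
  shows "uniform_body B W \<longleftrightarrow> reduced_subgroupoid B (material_groupoid B W)"
  \<comment> \<open>The subgroupoid half of reducedness is already available, so only transitivity
    is left to be matched with uniformity.\<close>
  using subgroupoid_material_groupoid[OF \<open>open B\<close>] uniform_body_iff_transitive_over
  by (auto simp: reduced_subgroupoid_def)

end
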